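(* Consider an autonomous system $\dot{\mathbf{x}}=\mathbf{h}(\mathbf{x})$ on $\mathbb{R}^n$ that is semi-contracting in a bounded metric $\mathbf{M}(\mathbf{x})$, and a scalar cost function $V:\mathbb{R}^n\to\mathbb{R}$ such that $\dot V(\mathbf{x})\le0$ for all $\mathbf{x}$. Assume that one trajectory is bounded. Let $\mathcal{I}$ be a forward invariant set where $\dot V=0$, and assume that the contraction condition $$\dot{\mathbf{P}}+\mathbf{A}^\top\mathbf{P}+\mathbf{P}\mathbf{A}\preceq-2\alpha\mathbf{P}$$ holds on $\mathcal{I}$ for some (possibly different) metric $\mathbf{P}$ and some $\alpha>0$. Then $\mathcal{I}$ is path connected, all system trajectories converge to a unique equilibrium $\mathbf{x}^\star\in\mathcal{I}$, and $V$ is globally minimized at $\mathbf{x}^\star$.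
   Context: All functions are assumed sufficiently smooth that derivatives of the necessary order exist and are continuous. $\dot V(\mathbf{x})=\nabla V(\mathbf{x})^\top\mathbf{h}(\mathbf{x})$ is the derivative of $V$ along the system. A metric is a function $\mathbf{P}:\mathbb{R}^n\to\mathbb{R}^{n\times n}$ whose values are symmetric positive definite matrices; $\mathbf{A}=\frac{\partial\mathbf{h}}{\partial\mathbf{x}}$ and $\dot{\mathbf{P}}=\sum_i\frac{\partial\mathbf{P}}{\partial x_i}h_i(\mathbf{x})$. A metric $\mathbf{M}$ is bounded if there are constants $\beta_0,\beta_1$ with $\mathbf{0}\prec\beta_0^2\mathbf{I}\preceq\mathbf{M}(\mathbf{x})\preceq\beta_1^2\mathbf{I}$ for all $\mathbf{x}$. The system is semi-contracting in $\mathbf{M}$ if $\dot{\mathbf{M}}+\mathbf{A}^\top\mathbf{M}+\mathbf{M}\mathbf{A}\preceq\mathbf{0}$ for all $\mathbf{x}\in\mathbb{R}^n$.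
   Formalization: The forward invariant set I where V̇=0 is assumed either closed and nonempty, or the largest such set; otherwise the claim fails, e.g. for I empty, or h(x)=−x, V=0, I=ℝ∖{0}. *)

theory Defs
  imports "HOL-Analysis.Analysis"
begin

definition cont_differentiable :: "('a::real_normed_vector \<Rightarrow> 'b::real_normed_vector) \<Rightarrow> bool" where
  "cont_differentiable f \<longleftrightarrow>
     (\<exists>f' :: 'a \<Rightarrow> 'a \<Rightarrow>\<^sub>L 'b.
        (\<forall>x. (f has_derivative blinfun_apply (f' x)) (at x)) \<and> continuous_on UNIV f')"

definition partial_deriv :: "'n \<Rightarrow> (real^'n::finite \<Rightarrow> 'b::real_normed_vector) \<Rightarrow> real^'n \<Rightarrow> 'b" where
  "partial_deriv i f x = frechet_derivative f (at x) (axis i 1)"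

definition grad :: "(real^'n::finite \<Rightarrow> real) \<Rightarrow> real^'n \<Rightarrow> real^'n" where
  "grad V x = (\<chi> i. partial_deriv i V x)"

definition orbital_deriv :: "(real^'n::finite \<Rightarrow> real^'n) \<Rightarrow> (real^'n \<Rightarrow> real) \<Rightarrow> real^'n \<Rightarrow> real" where
  "orbital_deriv h V x = grad V x \<bullet> h x"

definition metric_deriv ::
  "(real^'n::finite \<Rightarrow> real^'n) \<Rightarrow> (real^'n \<Rightarrow> real^'n^'n) \<Rightarrow> real^'n \<Rightarrow> real^'n^'n" where
  "metric_deriv h P x = (\<Sum>i\<in>UNIV. (h x $ i) *\<^sub>R partial_deriv i P x)"

definition psd_matrix :: "real^'n^'n::finite \<Rightarrow> bool" where
  "psd_matrix N \<longleftrightarrow> transpose N = N \<and> (\<forall>v. 0 \<le> v \<bullet> (N *v v))"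

definition pd_matrix :: "real^'n^'n::finite \<Rightarrow> bool" where
  "pd_matrix N \<longleftrightarrow> transpose N = N \<and> (\<forall>v. v \<noteq> 0 \<longrightarrow> 0 < v \<bullet> (N *v v))"

text \<open>The Loewner order. The library order on vectors and matrices is componentwise,
  hence a separate symbol.\<close>

definition loewner_le :: "real^'n^'n::finite \<Rightarrow> real^'n^'n \<Rightarrow> bool"  (infix "\<preceq>\<^sub>L" 50) where
  "N \<preceq>\<^sub>L N' \<longleftrightarrow> psd_matrix (N' - N)"

definition is_metric :: "(real^'n::finite \<Rightarrow> real^'n^'n) \<Rightarrow> bool" where
  "is_metric P \<longleftrightarrow> cont_differentiable P \<and> (\<forall>x. pd_matrix (P x))"

definition bounded_metric :: "(real^'n::finite \<Rightarrow> real^'n^'n) \<Rightarrow> bool" where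
  "bounded_metric M \<longleftrightarrow> is_metric M \<and>
     (\<exists>\<beta>\<^sub>0 \<beta>\<^sub>1 :: real. pd_matrix (mat (\<beta>\<^sub>0\<^sup>2) :: real^'n^'n) \<and>
        (\<forall>x. mat (\<beta>\<^sub>0\<^sup>2) \<preceq>\<^sub>L M x \<and> M x \<preceq>\<^sub>L mat (\<beta>\<^sub>1\<^sup>2)))"

definition contraction_lhs ::
  "(real^'n::finite \<Rightarrow> real^'n) \<Rightarrow> (real^'n \<Rightarrow> real^'n^'n) \<Rightarrow> real^'n \<Rightarrow> real^'n^'n" where
  "contraction_lhs h P x =
     (let A = jacobian h (at x)
      in metric_deriv h P x + transpose A ** P x + P x ** A)"

definition semi_contracting :: "(real^'n::finite \<Rightarrow> real^'n) \<Rightarrow> (real^'n \<Rightarrow> real^'n^'n) \<Rightarrow> bool" where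
  "semi_contracting h M \<longleftrightarrow> (\<forall>x. contraction_lhs h M x \<preceq>\<^sub>L 0)"

definition contracting_on ::
  "(real^'n::finite) set \<Rightarrow> (real^'n \<Rightarrow> real^'n) \<Rightarrow> (real^'n \<Rightarrow> real^'n^'n) \<Rightarrow> real \<Rightarrow> bool" where
  "contracting_on S h P \<alpha> \<longleftrightarrow> (\<forall>x\<in>S. contraction_lhs h P x \<preceq>\<^sub>L (- 2 * \<alpha>) *\<^sub>R P x)"

definition solution_on ::
  "('a::real_normed_vector \<Rightarrow> 'a) \<Rightarrow> (real \<Rightarrow> 'a) \<Rightarrow> real set \<Rightarrow> bool" where
  "solution_on h x J \<longleftrightarrow> (\<forall>t\<in>J. (x has_vector_derivative h (x t)) (at t within J))"

abbreviation trajectory :: "('a::real_normed_vector \<Rightarrow> 'a) \<Rightarrow> (real \<Rightarrow> 'a) \<Rightarrow> bool" where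
  "trajectory h x \<equiv> solution_on h x {0..}"

text \<open>Forward invariance quantifies over solutions on compact intervals, so that it also
  constrains initial values whose solution might not exist for all times.\<close>

definition forward_invariant :: "('a::real_normed_vector \<Rightarrow> 'a) \<Rightarrow> 'a set \<Rightarrow> bool" where
  "forward_invariant h S \<longleftrightarrow>
     (\<forall>x T. 0 \<le> T \<and> solution_on h x {0..T} \<and> x 0 \<in> S \<longrightarrow> x T \<in> S)"

definition stationary_invariant ::
  "(real^'n::finite \<Rightarrow> real^'n) \<Rightarrow> (real^'n \<Rightarrow> real) \<Rightarrow> (real^'n) set \<Rightarrow> bool" where
  "stationary_invariant h V S \<longleftrightarrow>
     forward_invariant h S \<and> (\<forall>x\<in>S. orbital_deriv h V x = 0)"

text \<open>Forward invariance and a vanishing orbital derivative alone admit the empty set and sets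
  missing their limit points: for \<open>h x = - x\<close> and constant \<open>V\<close>, the set of all nonzero reals
  is not connected and misses the equilibrium. The predicate below therefore accepts
  the two usual ways of excluding this: the set is closed and nonempty, or it is the largest
  set of its kind, as in LaSalle's invariance principle. In the second case it is not
  assumed to be closed or nonempty.\<close>

definition admissible_invariant ::
  "(real^'n::finite \<Rightarrow> real^'n) \<Rightarrow> (real^'n \<Rightarrow> real) \<Rightarrow> (real^'n) set \<Rightarrow> bool" where
  "admissible_invariant h V S \<longleftrightarrow>
     stationary_invariant h V S \<and>
     (closed S \<and> S \<noteq> {} \<or> (\<forall>S'. stationary_invariant h V S' \<longrightarrow> S' \<subseteq> S))"

end

theory Submission
  imports Defs
begin

text \<open>Two nearby solutions \<open>x\<close>, \<open>y\<close> are compared by \<open>W = (y - x) \<bullet> M x (y - x)\<close>: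
  linearizing \<open>h\<close> at \<open>x\<close> with a uniform remainder, semi-contraction gives
  \<open>W' \<le> \<epsilon> W\<close>, and subdividing the segment between distant initial values yields
  \<open>norm (y t - x t) \<le> K * norm (y 0 - x 0)\<close> without differentiating the flow.
  Hence all trajectories are bounded and exist globally. The set \<open>I\<close> contains a closed nonempty
  forward invariant set (\<open>I\<close> itself or, by LaSalle's argument, the limit set of a trajectory).
  Along a trajectory in it, the velocity \<open>h (x t)\<close> solves the variational equation and decays, so
  its limit points are equilibria. Contraction at such an equilibrium makes it locally
  attractive, and nonexpansion makes its basin of attraction open and closed.\<close>

section \<open>Global solutions of Lipschitz differential equations\<close>

text \<open>The gain \<open>1 / k\<close> over the growth rate of the integrand is the source of the
  contraction factor: Lipschitz constant \<open>l\<close> and weight rate \<open>k = 2 * l\<close>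
  give \<open>1 / 2\<close>.\<close>

lemma integral_exp_bound:
  fixes f :: "real \<Rightarrow> 'a::banach"
  assumes "continuous_on {0..r} f" "0 \<le> r" "0 < k" "0 \<le> c"
    and bd: "\<And>s. s \<in> {0..r} \<Longrightarrow> norm (f s) \<le> c * exp (k * s)"
  shows "norm (integral {0..r} f) \<le> c / k * exp (k * r)"
proof -
  have I: "((\<lambda>s. c * exp (k * s)) has_integral (c / k * exp (k * r) - c / k * exp (k * 0))) {0..r}"
    using assms(2,3)
    by (intro fundamental_theorem_of_calculus)
      (auto intro!: derivative_eq_intros simp flip: has_real_derivative_iff_has_vector_derivative)
  have "norm (integral {0..r} f) \<le> integral {0..r} (\<lambda>s. c * exp (k * s))"
    using bd assms(1)
    by (intro integral_norm_bound_integral integrable_continuous_real) (auto intro!: continuous_intros)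
  also have "\<dots> = c / k * exp (k * r) - c / k"
    using integral_unique[OF I] by simp
  also have "\<dots> \<le> c / k * exp (k * r)"
    using assms by simp
  finally show ?thesis .
qed

lemma integral_has_vector_derivative_atLeast:
  fixes f :: "real \<Rightarrow> 'a::banach"
  assumes "continuous_on {a..} f" "a \<le> r"
  shows "((\<lambda>u. integral {a..u} f) has_vector_derivative f r) (at r within {a..})"
proof -
  \<comment> \<open>Differentiability at \<open>r\<close> is local, so a compact interval suffices;
    the extra 1 keeps \<open>r\<close> off its right end.\<close>
  have "at r within {a..} = at r within {a..r + 1}"
    by (rule at_within_nhd[where S = "{..<r + 1}"]) auto
  moreover have "continuous_on {a..r + 1} f"
    by (rule continuous_on_subset[OF assms(1)]) auto
  ultimately show ?thesis
    using integral_has_vector_derivative[of a "r + 1" f r] assms(2) by simp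
qed

text \<open>Picard's iteration in the weighted norm \<open>sup exp (- 2 l t) * norm (x t - p)\<close> is a
  contraction on the whole half-line, so no continuation argument is needed.\<close>

lemma ex_trajectory_lipschitz:
  fixes g :: "'a::banach \<Rightarrow> 'a"
  assumes lip: "\<And>x y. norm (g x - g y) \<le> L * norm (x - y)"
  shows "\<exists>x. x 0 = p \<and> trajectory g x"
proof -
  \<comment> \<open>\<open>L\<close> may be zero or negative, whereas the weights require division
    by a positive constant.\<close>
  define l where "l = max L 1"
  have l: "l > 0" by (simp add: l_def)
  have lip_l: "norm (g x - g y) \<le> l * norm (x - y)" for x y
    using lip[of x y] mult_right_mono[of L l "norm (x - y)"] by (simp add: l_def)
  have "continuous_on UNIV g"
    by (rule lipschitz_on_continuous_on[of l], rule lipschitz_onI)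
      (use lip_l l in \<open>auto simp: dist_norm\<close>)
  then have cont_g: "continuous_on S (\<lambda>x. g (\<phi> x))" if "continuous_on S \<phi>" for S and \<phi> :: "real \<Rightarrow> 'a"
    using that continuous_on_compose2 by blast
  \<comment> \<open>The unknown \<open>u\<close> encodes the weighted curve
    \<open>exp (- 2 * l * t) *\<^sub>R (x t - p)\<close>, so \<open>f u\<close> is \<open>g\<close>
    along the decoded curve and \<open>F u\<close> is the re-encoded Picard iterate. Since bounded
    continuous functions live on all of the real line, \<open>max 0 t\<close> extends
    \<open>F u\<close> by zero to negative times.\<close>
  define f where "f u s = g (p + exp (2 * l * s) *\<^sub>R apply_bcontfun u s)" for u s
  define F where "F u t = exp (- (2 * l * max 0 t)) *\<^sub>R integral {0..max 0 t} (f u)" for u t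
  have cont_f: "continuous_on S (f u)" for S u
    unfolding f_def by (intro cont_g continuous_intros) auto
  have int_deriv: "((\<lambda>r. integral {0..r} (f u)) has_vector_derivative f u r) (at r within {0..})"
    if "0 \<le> r" for u r
    by (rule integral_has_vector_derivative_atLeast) (use that cont_f in auto)
  have cont_int: "continuous_on {0..} (\<lambda>r. integral {0..r} (f u))" for u
    unfolding continuous_on_eq_continuous_within
    using int_deriv has_vector_derivative_continuous by blast
  have cont_F: "continuous_on UNIV (F u)" for u
    unfolding F_def
    by (intro continuous_intros continuous_on_compose2[OF cont_int]) auto
  have f_diff: "norm (f u s - f v s) \<le> l * dist u v * exp (2 * l * s)" for u v s
  proof -
    have "norm (f u s - f v s) \<le> l * norm (exp (2 * l * s) *\<^sub>R (apply_bcontfun u s - apply_bcontfun v s))"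
      unfolding f_def by (rule order_trans[OF lip_l]) (simp add: scaleR_diff_right)
    also have "\<dots> \<le> l * (exp (2 * l * s) * dist u v)"
      using dist_bounded[of u s v] l by (auto intro!: mult_left_mono simp: dist_norm)
    finally show ?thesis by (simp add: mult_ac)
  qed
  have F_diff: "norm (F u t - F v t) \<le> 1 / 2 * dist u v" for u v t
  proof -
    let ?r = "max 0 t"
    have "norm (integral {0..?r} (\<lambda>s. f u s - f v s)) \<le> l * dist u v / (2 * l) * exp (2 * l * ?r)"
      by (rule integral_exp_bound) (use l f_diff cont_f in \<open>auto intro!: continuous_intros\<close>)
    moreover have "F u t - F v t = exp (- (2 * l * ?r)) *\<^sub>R integral {0..?r} (\<lambda>s. f u s - f v s)"
      unfolding F_def
      by (subst integral_diff) (auto intro!: integrable_continuous_real cont_f simp: scaleR_diff_right)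
    ultimately have "norm (F u t - F v t) \<le> exp (- (2 * l * ?r)) * (l * dist u v / (2 * l) * exp (2 * l * ?r))"
      by (auto intro!: mult_left_mono)
    also have "\<dots> = 1 / 2 * dist u v"
      using l by (simp add: field_simps flip: exp_add)
    finally show ?thesis .
  qed
  \<comment> \<open>A bound at the zero curve, together with \<open>F_diff\<close>, makes every
    \<open>F u\<close> bounded, so that \<open>F\<close> maps the Banach space into itself.\<close>
  have F0: "norm (F 0 t) \<le> norm (g p) / (2 * l)" for t
  proof -
    let ?r = "max 0 t"
    have "norm (integral {0..?r} (f 0)) \<le> norm (g p) / (2 * l) * exp (2 * l * ?r)"
      by (rule integral_exp_bound)
        (use l cont_f in \<open>auto simp: f_def zero_bcontfun.rep_eq mult_le_cancel_left1\<close>)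
    then have "norm (F 0 t) \<le> exp (- (2 * l * ?r)) * (norm (g p) / (2 * l) * exp (2 * l * ?r))"
      unfolding F_def norm_scaleR abs_exp_cancel by (rule mult_left_mono) simp
    also have "\<dots> = norm (g p) / (2 * l)"
      by (simp add: field_simps flip: exp_add)
    finally show ?thesis .
  qed
  have "F u \<in> bcontfun" for u
  proof (rule bcontfun_normI[OF cont_F])
    show "norm (F u t) \<le> norm (g p) / (2 * l) + 1 / 2 * dist u 0" for t
      using F0[of t] F_diff[of u t 0]
        norm_triangle_sub[of "F u t" "F 0 t"] by linarith
  qed
  then have app: "apply_bcontfun (Bcontfun (F u)) = F u" for u
    by (simp add: Bcontfun_inverse)
  have "dist (Bcontfun (F u)) (Bcontfun (F v)) \<le> 1 / 2 * dist u v" for u v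
    by (rule dist_bound) (use F_diff app in \<open>auto simp: dist_norm\<close>)
  then obtain u where "Bcontfun (F u) = u"
    using banach_fix_type[of "1 / 2" "\<lambda>u. Bcontfun (F u)"] by auto
  then have u: "apply_bcontfun u t = F u t" for t
    using app[of u] by metis
  define x where "x t = p + integral {0..t} (f u)" for t
  \<comment> \<open>At the fixed point the two exponential weights cancel, leaving the integral
    equation for \<open>x\<close>.\<close>
  have f_eq: "f u t = g (x t)" if "0 \<le> t" for t
    unfolding x_def f_def[of u t] u[of t] F_def using that by (simp flip: exp_add)
  have "(x has_vector_derivative g (x t)) (at t within {0..})" if "0 \<le> t" for t
    using has_vector_derivative_add[OF has_vector_derivative_const int_deriv[OF that, of u], of p] f_eq[OF that]
    unfolding x_def by simp
  then show ?thesis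
    by (intro exI[of _ x]) (simp add: solution_on_def x_def)
qed

section \<open>Quadratic forms along solutions\<close>

lemma cont_differentiableE:
  assumes "cont_differentiable f"
  obtains f' where "\<And>x. (f has_derivative blinfun_apply (f' x)) (at x)"
    "\<And>x. frechet_derivative f (at x) = blinfun_apply (f' x)" "continuous_on UNIV f'"
  using assms frechet_derivative_at unfolding cont_differentiable_def by metis

lemma cont_differentiable_has_derivative:
  "cont_differentiable f \<Longrightarrow> (f has_derivative frechet_derivative f (at x)) (at x)"
  by (metis cont_differentiableE)

lemma cont_differentiable_continuous: "cont_differentiable f \<Longrightarrow> continuous_on S f"
  by (meson cont_differentiable_has_derivative has_derivative_at_withinI has_derivative_continuous_on)

text \<open>This turns the coordinate sums in \<open>metric_deriv\<close> and
  \<open>orbital_deriv\<close> into total derivatives applied to \<open>h x\<close>, the form in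
  which the chain rule produces them.\<close>

lemma sum_component_axis:
  fixes L :: "real^'n::finite \<Rightarrow> 'b::real_normed_vector"
  assumes "linear L"
  shows "(\<Sum>i\<in>UNIV. (v $ i) *\<^sub>R L (axis i 1)) = L v"
proof -
  have "L v = L (\<Sum>i\<in>UNIV. (v $ i) *\<^sub>R axis i 1)"
    using basis_expansion[of v] by (simp add: scalar_mult_eq_scaleR)
  then show ?thesis
    using assms by (simp add: linear_sum linear_scale)
qed

lemma metric_deriv_eq:
  "cont_differentiable P \<Longrightarrow> metric_deriv h P x = frechet_derivative P (at x) (h x)"
  unfolding metric_deriv_def partial_deriv_def
  by (rule sum_component_axis) (meson cont_differentiable_has_derivative has_derivative_linear)

lemma orbital_deriv_eq:
  assumes "cont_differentiable V"
  shows "orbital_deriv h V x = frechet_derivative V (at x) (h x)"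
proof -
  have "linear (frechet_derivative V (at x))"
    by (meson assms cont_differentiable_has_derivative has_derivative_linear)
  from sum_component_axis[OF this, of "h x"] show ?thesis
    by (simp add: orbital_deriv_def grad_def partial_deriv_def inner_vec_def mult.commute)
qed

lemma jacobian_vector:
  fixes h :: "real^'n::finite \<Rightarrow> real^'n"
  assumes "cont_differentiable h"
  shows "jacobian h (at x) *v w = frechet_derivative h (at x) w"
  unfolding jacobian_def
  by (rule matrix_works) (meson assms cont_differentiable_has_derivative has_derivative_linear
      linear_matrix_vector_mul_eq)

section \<open>Matrix inequalities as inequalities of quadratic forms\<close>

lemma bounded_bilinear_matrix_vector:
  "bounded_bilinear (\<lambda>(A :: real^'n^'m::finite) (v :: real^'n::finite). A *v v)"
  by (subst bilinear_conv_bounded_bilinear[symmetric])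
    (auto simp: bilinear_def algebra_simps scaleR_matrix_vector_assoc intro!: linearI)

lemma symmetric_matrix_swap:
  fixes N :: "real^'n^'n::finite"
  assumes "transpose N = N"
  shows "v \<bullet> (N *v w) = w \<bullet> (N *v v)"
  using assms by (metis dot_lmul_matrix inner_commute transpose_matrix_vector)

text \<open>Symmetry of \<open>P x\<close> makes the two Jacobian terms contribute equally. The
  right-hand side is the derivative of the metric form along a solution of the variational
  equation.\<close>

lemma contraction_lhs_form:
  assumes "transpose (P x) = P x"
  shows "v \<bullet> (contraction_lhs h P x *v v) =
    v \<bullet> (metric_deriv h P x *v v) + 2 * (v \<bullet> (P x *v (jacobian h (at x) *v v)))"
proof -
  have "v \<bullet> ((transpose A ** P x) *v v) = v \<bullet> (P x *v (A *v v))" for A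
    using symmetric_matrix_swap[OF assms, of v "A *v v"]
    by (simp add: inner_commute dot_lmul_matrix flip: matrix_vector_mul_assoc transpose_matrix_vector)
      (metis dot_lmul_matrix inner_commute transpose_matrix_vector transpose_transpose)
  then show ?thesis
    by (simp add: contraction_lhs_def Let_def matrix_vector_mult_add_rdistrib inner_add_right
        matrix_vector_mul_assoc)
qed

lemma loewner_leD: "N \<preceq>\<^sub>L N' \<Longrightarrow> v \<bullet> (N *v v) \<le> v \<bullet> (N' *v v)"
  by (auto simp: loewner_le_def psd_matrix_def matrix_vector_mult_diff_rdistrib inner_diff_right)

lemma mat_vector: "mat c *v v = c *\<^sub>R (v :: real^'n::finite)"
proof -
  have "mat c = c *\<^sub>R (mat 1 :: real^'n^'n)"
    by (simp add: mat_def vec_eq_iff)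
  then show ?thesis
    by (simp flip: scaleR_matrix_vector_assoc)
qed

lemma is_metricD:
  assumes "is_metric P"
  shows "cont_differentiable P" "transpose (P x) = P x" "v \<noteq> 0 \<Longrightarrow> 0 < v \<bullet> (P x *v v)"
  using assms by (auto simp: is_metric_def pd_matrix_def)

lemma bounded_metricE:
  fixes M :: "real^'n::finite \<Rightarrow> real^'n^'n"
  assumes "bounded_metric M"
  obtains a b where "0 < a" "0 < b"
    "\<And>x v. a * (norm v)\<^sup>2 \<le> v \<bullet> (M x *v v)" "\<And>x v. v \<bullet> (M x *v v) \<le> b * (norm v)\<^sup>2"
proof -
  obtain \<beta>0 \<beta>1 where pd: "pd_matrix (mat (\<beta>0\<^sup>2) :: real^'n^'n)"
    and bd: "\<And>x. mat (\<beta>0\<^sup>2) \<preceq>\<^sub>L M x \<and> M x \<preceq>\<^sub>L mat (\<beta>1\<^sup>2)"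
    using assms by (auto simp: bounded_metric_def)
  have "0 < axis undefined 1 \<bullet> (mat (\<beta>0\<^sup>2) *v (axis undefined 1 :: real^'n))"
    using pd unfolding pd_matrix_def by (auto simp: axis_eq_0_iff)
  then have "0 < \<beta>0\<^sup>2"
    by (simp add: mat_vector inner_axis_axis)
  moreover have "\<beta>0\<^sup>2 * (norm v)\<^sup>2 \<le> v \<bullet> (M x *v v)" for x v
    using loewner_leD[of "mat (\<beta>0\<^sup>2)" "M x" v] bd by (simp add: mat_vector power2_norm_eq_inner)
  \<comment> \<open>Adding 1 makes the upper constant visibly positive.\<close>
  moreover have "v \<bullet> (M x *v v) \<le> (\<beta>1\<^sup>2 + 1) * (norm v)\<^sup>2" for x v
    using loewner_leD[of "M x" "mat (\<beta>1\<^sup>2)" v] bd[of x]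
    by (simp add: mat_vector power2_norm_eq_inner distrib_right) (smt (verit) inner_ge_zero)
  ultimately show ?thesis
    using that[of "\<beta>0\<^sup>2" "\<beta>1\<^sup>2 + 1"] by (smt (verit) zero_le_power2)
qed

lemma matrix_field_bound:
  fixes P :: "real^'n::finite \<Rightarrow> real^'n^'n"
  assumes "continuous_on UNIV P" "compact C"
  obtains B where "0 < B" "\<And>x v. x \<in> C \<Longrightarrow> norm (P x *v v) \<le> B * norm v"
proof -
  obtain K where K: "K > 0" "\<And>(N :: real^'n^'n) v. norm (N *v v) \<le> norm N * norm v * K"
    using bounded_bilinear.pos_bounded[OF bounded_bilinear_matrix_vector] by blast
  have "bounded (P ` C)"
    by (intro compact_imp_bounded compact_continuous_image continuous_on_subset[OF assms(1)] assms(2)) auto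
  then obtain B where B: "B > 0" "\<And>x. x \<in> C \<Longrightarrow> norm (P x) \<le> B"
    unfolding bounded_pos by auto
  show ?thesis
  proof (rule that[of "B * K"])
    fix x v assume "x \<in> C"
    have "norm (P x *v v) \<le> norm (P x) * (norm v * K)"
      using K(2)[of "P x" v] by (simp add: mult_ac)
    also have "\<dots> \<le> B * (norm v * K)"
      using B(2)[OF \<open>x \<in> C\<close>] K(1) by (intro mult_right_mono) auto
    finally show "norm (P x *v v) \<le> B * K * norm v" by (simp add: mult_ac)
  qed (use B K in simp)
qed

text \<open>A general metric comes without uniform bounds. On a compact set the constant is the
  minimum of the form over \<open>C\<close> times the unit sphere, and homogeneity extends it to all
  \<open>v\<close>.\<close>

lemma metric_coercive:
  fixes P :: "real^'n::finite \<Rightarrow> real^'n^'n"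
  assumes "is_metric P" "compact C"
  obtains c where "0 < c" "\<And>x v. x \<in> C \<Longrightarrow> c * (norm v)\<^sup>2 \<le> v \<bullet> (P x *v v)"
proof (cases "C = {}")
  case True
  then show ?thesis using that[of 1] by auto
next
  case False
  let ?q = "\<lambda>z. snd z \<bullet> (P (fst z) *v snd z)"
  let ?S = "sphere 0 1 :: (real^'n) set"
  have cont: "continuous_on (C \<times> ?S) ?q"
    by (intro continuous_intros bounded_bilinear.continuous_on[OF bounded_bilinear_matrix_vector]
        continuous_on_compose2[OF cont_differentiable_continuous[OF is_metricD(1)[OF assms(1)], of UNIV]]) auto
  have "(axis undefined 1 :: real^'n) \<in> ?S" by simp
  then have "C \<times> ?S \<noteq> {}" using False by blast
  then obtain z where z: "z \<in> C \<times> ?S" "\<And>z'. z' \<in> C \<times> ?S \<Longrightarrow> ?q z \<le> ?q z'"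
    using continuous_attains_inf[OF compact_Times[OF assms(2) compact_sphere] _ cont] by blast
  show ?thesis
  proof (rule that[of "?q z"])
    have "snd z \<noteq> 0" using z(1) by auto
    then show "0 < ?q z" using is_metricD(3)[OF assms(1)] by blast
    fix x and v :: "real^'n" assume x: "x \<in> C"
    show "?q z * (norm v)\<^sup>2 \<le> v \<bullet> (P x *v v)"
    proof (cases "v = 0")
      case False
      define u where "u = (1 / norm v) *\<^sub>R v"
      have v: "v = norm v *\<^sub>R u" and "norm u = 1" using False by (auto simp: u_def)
      then have "?q z \<le> u \<bullet> (P x *v u)"
        using z(2)[of "(x, u)"] x by simp
      then have "?q z * (norm v)\<^sup>2 \<le> (u \<bullet> (P x *v u)) * (norm v)\<^sup>2"
        by (rule mult_right_mono) simp
      also have "\<dots> = v \<bullet> (P x *v v)"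
        by (subst (2 3) v) (simp add: matrix_vector_mult_scaleR power2_eq_square)
      finally show ?thesis .
    qed simp
  qed
qed

lemma quadratic_form_has_derivative:
  fixes N :: "real \<Rightarrow> real^'n^'n::finite"
  assumes "(N has_vector_derivative N') (at t within S)" "(w has_vector_derivative w') (at t within S)"
    and "transpose (N t) = N t"
  shows "((\<lambda>t. w t \<bullet> (N t *v w t)) has_real_derivative
    w t \<bullet> (N' *v w t) + 2 * (w t \<bullet> (N t *v w'))) (at t within S)"
proof -
  have "((\<lambda>t. N t *v w t) has_vector_derivative N t *v w' + N' *v w t) (at t within S)"
    by (rule bounded_bilinear.has_vector_derivative[OF bounded_bilinear_matrix_vector assms(1,2)])
  from bounded_bilinear.has_vector_derivative[OF bounded_bilinear_inner assms(2) this]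
  show ?thesis
    using symmetric_matrix_swap[OF assms(3), of "w t" w']
    by (simp add: has_real_derivative_iff_has_vector_derivative inner_add_right inner_commute add_ac)
qed

lemma has_vector_derivative_along:
  assumes "cont_differentiable f" "(x has_vector_derivative x') (at t within S)"
  shows "((\<lambda>t. f (x t)) has_vector_derivative frechet_derivative f (at (x t)) x') (at t within S)"
  using vector_derivative_diff_chain_within[OF assms(2)
      has_derivative_at_withinI[OF cont_differentiable_has_derivative[OF assms(1)]]]
  by (simp add: o_def)

text \<open>The derivative \<open>w'\<close> is left free: it serves both for the exact difference
  of two velocities and for the variational equation.\<close>

lemma metric_form_has_derivative:
  fixes P :: "real^'n::finite \<Rightarrow> real^'n^'n"
  assumes "is_metric P" "(x has_vector_derivative h (x t)) (at t within S)"
    "(w has_vector_derivative w') (at t within S)"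
  shows "((\<lambda>t. w t \<bullet> (P (x t) *v w t)) has_real_derivative
    w t \<bullet> (metric_deriv h P (x t) *v w t) + 2 * (w t \<bullet> (P (x t) *v w'))) (at t within S)"
  using quadratic_form_has_derivative[OF has_vector_derivative_along[OF is_metricD(1)[OF assms(1)] assms(2)]
      assms(3) is_metricD(2)[OF assms(1)]]
  by (simp add: metric_deriv_eq[OF is_metricD(1)[OF assms(1)]])

section \<open>Differential inequalities and uniform linearization\<close>

lemma solution_on_continuous: "solution_on h x J \<Longrightarrow> continuous_on J x"
  unfolding solution_on_def continuous_on_eq_continuous_within
  using has_vector_derivative_continuous by blast

lemma solution_on_subset: "solution_on h x J \<Longrightarrow> J' \<subseteq> J \<Longrightarrow> solution_on h x J'"
  unfolding solution_on_def using has_vector_derivative_within_subset by blast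

text \<open>The function \<open>exp (- (c * t)) * f t\<close> is nonincreasing. The inequality is
  demanded at interior times only, which suits a first-exit argument, and \<open>c\<close> may have
  any sign.\<close>

lemma gronwall_differential:
  fixes f :: "real \<Rightarrow> real"
  assumes "0 \<le> T"
    and deriv: "\<And>t. t \<in> {0..T} \<Longrightarrow> (f has_real_derivative f' t) (at t within {0..T})"
    and le: "\<And>t. 0 < t \<Longrightarrow> t < T \<Longrightarrow> f' t \<le> c * f t"
  shows "f T \<le> exp (c * T) * f 0"
proof -
  let ?g = "\<lambda>t. exp (- (c * t)) * f t"
  have "?g 0 \<ge> ?g T"
  proof (rule DERIV_nonpos_imp_decreasing_open[OF assms(1)])
    fix t assume t: "0 < t" "t < T"
    have "(f has_real_derivative f' t) (at t)"
      using deriv[of t] t at_within_Icc_at[of 0 t T] by simp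
    then have "(?g has_real_derivative exp (- (c * t)) * (f' t - c * f t)) (at t)"
      by (auto intro!: derivative_eq_intros simp: algebra_simps)
    moreover have "exp (- (c * t)) * (f' t - c * f t) \<le> 0"
      using le[OF t] by (simp add: mult_le_0_iff)
    ultimately show "\<exists>D. (?g has_real_derivative D) (at t) \<and> D \<le> 0" by blast
  next
    show "continuous_on {0..T} ?g"
      by (intro continuous_intros DERIV_continuous_on[OF deriv])
  qed
  then have "exp (c * T) * ?g T \<le> exp (c * T) * f 0" by simp
  then show ?thesis by (simp add: mult.assoc[symmetric] flip: exp_add)
qed

text \<open>The derivative is uniformly continuous on a ball, so the mean value inequality bounds
  the remainder with a \<open>d\<close> that does not depend on \<open>x\<close>.\<close>

lemma uniform_linearization:
  fixes f :: "'a::euclidean_space \<Rightarrow> 'b::real_normed_vector"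
  assumes "cont_differentiable f" "0 < e"
  obtains d where "0 < d"
    "\<And>x y. norm x \<le> R \<Longrightarrow> norm (y - x) \<le> d \<Longrightarrow>
      norm (f y - f x - frechet_derivative f (at x) (y - x)) \<le> e * norm (y - x)"
proof -
  obtain f' where f': "\<And>x. (f has_derivative blinfun_apply (f' x)) (at x)"
    "\<And>x. frechet_derivative f (at x) = blinfun_apply (f' x)" "continuous_on UNIV f'"
    using cont_differentiableE[OF assms(1)] by metis
  have "uniformly_continuous_on (cball 0 (R + 1)) f'"
    by (intro compact_uniformly_continuous continuous_on_subset[OF f'(3)]) auto
  then obtain d where d: "d > 0"
    "\<And>x z. x \<in> cball 0 (R + 1) \<Longrightarrow> z \<in> cball 0 (R + 1) \<Longrightarrow> dist z x < d \<Longrightarrow> dist (f' z) (f' x) < e"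
    unfolding uniformly_continuous_on_def using assms(2) by metis
  show ?thesis
  \<comment> \<open>The bound 1 keeps the points compared inside radius \<open>R + 1\<close>;
    halving \<open>d\<close> makes the distance strictly less than \<open>d\<close>.\<close>
  proof (rule that[of "min (d / 2) 1"])
    fix x y :: 'a assume x: "norm x \<le> R" and y: "norm (y - x) \<le> min (d / 2) 1"
    let ?S = "cball x (norm (y - x))"
    have "norm (f y - f x - f' x (y - x)) \<le> norm (y - x) * e"
    proof (rule differentiable_bound_linearization[where S = ?S])
      show "x + t *\<^sub>R (y - x) \<in> ?S" if "t \<in> {0..1}" for t
        using that by (simp add: dist_norm mult_left_le_one_le)
      show "(f has_derivative blinfun_apply (f' z)) (at z within ?S)" if "z \<in> ?S" for z
        using f'(1) has_derivative_at_withinI by blast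
      show "onorm (blinfun_apply (f' z) - blinfun_apply (f' x)) \<le> e" if z: "z \<in> ?S" for z
      proof -
        have "norm (z - x) \<le> min (d / 2) 1"
          using z y by (simp add: dist_norm norm_minus_commute)
        moreover have "norm z \<le> norm x + norm (z - x)"
          by (metis norm_triangle_sub)
        ultimately have "dist (f' z) (f' x) < e"
          using x d(1) by (intro d(2)) (auto simp: dist_norm)
        then show ?thesis
          by (simp add: dist_norm norm_blinfun.rep_eq minus_blinfun.rep_eq fun_diff_def)
      qed
    qed simp
    then show "norm (f y - f x - frechet_derivative f (at x) (y - x)) \<le> e * norm (y - x)"
      by (simp add: f'(2) mult.commute)
  qed (use d in simp)
qed

section \<open>Nonexpansion of nearby solutions\<close>

text \<open>The constant \<open>K\<close> depends on the bounds of \<open>M\<close> alone, while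
  \<open>d\<close> may depend on \<open>R\<close> and \<open>T\<close>; hence the estimates for many
  short steps add up with one \<open>K\<close>. The second curve may solve another field
  \<open>g\<close> that equals \<open>h\<close> on a larger ball, because global existence is so far
  known only for Lipschitz fields.\<close>

lemma semi_contracting_nearby:
  fixes h :: "real^'n::finite \<Rightarrow> real^'n"
  assumes h: "cont_differentiable h" and M: "bounded_metric M" and sc: "semi_contracting h M"
  obtains K where "0 < K"
    "\<And>R T. 0 \<le> T \<Longrightarrow> \<exists>d>0. \<forall>x y g.
       solution_on h x {0..T} \<longrightarrow> (\<forall>t\<in>{0..T}. norm (x t) \<le> R) \<longrightarrow>
       solution_on g y {0..T} \<longrightarrow> (\<forall>z. norm z \<le> R + 1 \<longrightarrow> g z = h z) \<longrightarrow>
       norm (y 0 - x 0) \<le> d \<longrightarrow> (\<forall>t\<in>{0..T}. norm (y t - x t) \<le> K * norm (y 0 - x 0))"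
proof -
  have met: "is_metric M" using M by (simp add: bounded_metric_def)
  obtain a b where ab: "0 < a" "0 < b"
    "\<And>x v. a * (norm v)\<^sup>2 \<le> v \<bullet> (M x *v v)" "\<And>x v. v \<bullet> (M x *v v) \<le> b * (norm v)\<^sup>2"
    using bounded_metricE[OF M] by blast
  \<comment> \<open>The 3 bounds \<open>exp 1\<close>, the total growth of \<open>W\<close> on the
    interval; \<open>b / a\<close> is the cost of passing between \<open>W\<close> and the squared
    norm.\<close>
  define K where "K = sqrt (3 * b / a)"
  have K: "0 < K" "K\<^sup>2 = 3 * b / a" using ab(1,2) by (simp_all add: K_def)
  show thesis
  proof (rule that[OF K(1)])
    fix R T :: real assume T: "0 \<le> T"
    obtain B where B: "0 < B" "\<And>x v. x \<in> cball 0 R \<Longrightarrow> norm (M x *v v) \<le> B * norm v"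
      using matrix_field_bound[OF cont_differentiable_continuous[OF is_metricD(1)[OF met]] compact_cball]
      by blast
    \<comment> \<open>With this \<open>e\<close> the linearization remainder adds at most the rate
      \<open>1 / (T + 1)\<close>, so \<open>W\<close> grows by less than \<open>exp 1\<close> up to
      time \<open>T\<close>.\<close>
    define e where "e = a / (2 * B * (T + 1))"
    have e: "0 < e" using ab B T by (simp add: e_def)
    have Be: "2 * (B * e) = 1 / (T + 1) * a" using B(1) T by (simp add: e_def divide_simps)
    obtain \<delta>0 where \<delta>0: "0 < \<delta>0" "\<And>x y. norm x \<le> R \<Longrightarrow> norm (y - x) \<le> \<delta>0 \<Longrightarrow>
      norm (h y - h x - frechet_derivative h (at x) (y - x)) \<le> e * norm (y - x)"
      using uniform_linearization[OF h e] by blast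
    \<comment> \<open>The cap 1 keeps \<open>y t\<close> in the ball of radius \<open>R + 1\<close>,
      where \<open>g\<close> and \<open>h\<close> agree.\<close>
    define \<delta> where "\<delta> = min \<delta>0 1"
    have \<delta>: "0 < \<delta>" using \<delta>0 by (simp add: \<delta>_def)
    have growth: "w \<bullet> (metric_deriv h M x *v w) + 2 * (w \<bullet> (M x *v (h y - h x)))
        \<le> 1 / (T + 1) * (w \<bullet> (M x *v w))"
      if x: "norm x \<le> R" and w: "w = y - x" "norm w \<le> \<delta>" for x y w
    proof -
      let ?r = "h y - h x - jacobian h (at x) *v w"
      have r: "norm ?r \<le> e * norm w"
        using \<delta>0(2)[OF x, of y] w by (simp add: \<delta>_def jacobian_vector[OF h])
      have "w \<bullet> (metric_deriv h M x *v w) + 2 * (w \<bullet> (M x *v (h y - h x)))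
          = w \<bullet> (contraction_lhs h M x *v w) + 2 * (w \<bullet> (M x *v ?r))"
        by (simp add: contraction_lhs_form[OF is_metricD(2)[OF met]] matrix_vector_mult_diff_distrib
            inner_diff_right)
      also have "\<dots> \<le> 2 * (w \<bullet> (M x *v ?r))"
        using loewner_leD sc unfolding semi_contracting_def by fastforce
      also have "\<dots> \<le> 2 * (norm w * (B * (e * norm w)))"
      proof -
        have "norm (M x *v ?r) \<le> B * norm ?r" using B(2)[of x ?r] x by simp
        also have "\<dots> \<le> B * (e * norm w)" using r B(1) by simp
        finally have "norm w * norm (M x *v ?r) \<le> norm w * (B * (e * norm w))"
          by (rule mult_left_mono) simp
        then show ?thesis
          using norm_cauchy_schwarz[of w "M x *v ?r"] by simp
      qed
      also have "\<dots> = 2 * (B * e) * (norm w)\<^sup>2" by (simp add: power2_eq_square)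
      also have "\<dots> = 1 / (T + 1) * (a * (norm w)\<^sup>2)" unfolding Be by simp
      also have "\<dots> \<le> 1 / (T + 1) * (w \<bullet> (M x *v w))"
        using ab(3) T by (intro mult_left_mono) auto
      finally show ?thesis by simp
    qed
    show "\<exists>d>0. \<forall>x y g. solution_on h x {0..T} \<longrightarrow> (\<forall>t\<in>{0..T}. norm (x t) \<le> R) \<longrightarrow>
       solution_on g y {0..T} \<longrightarrow> (\<forall>z. norm z \<le> R + 1 \<longrightarrow> g z = h z) \<longrightarrow>
       norm (y 0 - x 0) \<le> d \<longrightarrow> (\<forall>t\<in>{0..T}. norm (y t - x t) \<le> K * norm (y 0 - x 0))"
    \<comment> \<open>The factor 2 makes \<open>K * norm (w 0)\<close> strictly smaller than
      \<delta>, as the exit argument needs.\<close>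
    proof (intro exI[of _ "\<delta> / (2 * K)"] conjI allI impI)
      fix x y :: "real \<Rightarrow> real^'n" and g :: "real^'n \<Rightarrow> real^'n"
      assume x: "solution_on h x {0..T}" "\<forall>t\<in>{0..T}. norm (x t) \<le> R"
        and y: "solution_on g y {0..T}" and g: "\<forall>z. norm z \<le> R + 1 \<longrightarrow> g z = h z"
        and d: "norm (y 0 - x 0) \<le> \<delta> / (2 * K)"
      define w where "w t = y t - x t" for t
      define W where "W t = w t \<bullet> (M (x t) *v w t)" for t
      have W_deriv: "(W has_real_derivative w t \<bullet> (metric_deriv h M (x t) *v w t)
          + 2 * (w t \<bullet> (M (x t) *v (g (y t) - h (x t))))) (at t within {0..T})"
        if "t \<in> {0..T}" for t
        unfolding W_def
        by (rule metric_form_has_derivative[OF met])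
          (use x y that in \<open>auto simp: w_def[abs_def] solution_on_def intro!: has_vector_derivative_diff\<close>)
      have bound: "norm (w s) \<le> K * norm (w 0)"
        if s: "s \<in> {0..T}" and near: "\<And>t. 0 < t \<Longrightarrow> t < s \<Longrightarrow> norm (w t) \<le> \<delta>" for s
      proof -
        have "W s \<le> exp (1 / (T + 1) * s) * W 0"
        proof (rule gronwall_differential)
          show "(W has_real_derivative w t \<bullet> (metric_deriv h M (x t) *v w t)
              + 2 * (w t \<bullet> (M (x t) *v (g (y t) - h (x t))))) (at t within {0..s})"
            if "t \<in> {0..s}" for t
            by (rule DERIV_subset[OF W_deriv]) (use that s in auto)
          fix t assume t: "0 < t" "t < s"
          have xt: "norm (x t) \<le> R" using x(2) t s by simp
          have "norm (y t) \<le> norm (x t) + norm (w t)"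
            unfolding w_def by (rule norm_triangle_sub)
          then have "g (y t) = h (y t)"
            using g xt near[OF t] by (auto simp: \<delta>_def)
          then show "w t \<bullet> (metric_deriv h M (x t) *v w t)
              + 2 * (w t \<bullet> (M (x t) *v (g (y t) - h (x t)))) \<le> 1 / (T + 1) * W t"
            unfolding W_def using growth[OF xt w_def near[OF t]] by simp
        qed (use s in simp)
        moreover have "1 / (T + 1) * s \<le> 1" using s by simp
        then have "exp (1 / (T + 1) * s) \<le> 3"
          using exp_le by (meson exp_le_cancel_iff order_trans)
        moreover have "0 \<le> W 0"
          unfolding W_def using ab(1) ab(3)[of "w 0" "x 0"] by (smt (verit) zero_le_mult_iff zero_le_power2)
        ultimately have "W s \<le> 3 * W 0"
          by (meson mult_right_mono order_trans)
        moreover have "a * (norm (w s))\<^sup>2 \<le> W s" "W 0 \<le> b * (norm (w 0))\<^sup>2"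
          unfolding W_def using ab by auto
        ultimately have "a * (norm (w s))\<^sup>2 \<le> 3 * (b * (norm (w 0))\<^sup>2)" by linarith
        then have "(norm (w s))\<^sup>2 \<le> (K * norm (w 0))\<^sup>2"
          using ab(1) by (simp add: power_mult_distrib K(2) field_simps)
        then show ?thesis
          by (rule power2_le_imp_le) (use K in simp)
      qed
      have small: "K * norm (w 0) < \<delta>"
        using d K(1) \<delta> by (simp add: w_def field_simps)
      \<comment> \<open>First exit: at the earliest time \<open>s\<close> with
        \<open>norm (w s)\<close> at least \<delta>, all earlier times are controlled, so
        \<open>bound\<close> applies at \<open>s\<close> and contradicts
        \<open>small\<close>.\<close>
      have near: "norm (w t) < \<delta>" if "t \<in> {0..T}" for t
      proof (rule ccontr)
        let ?C = "{0..T} \<inter> (\<lambda>t. norm (w t)) -` {\<delta>..}"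
        assume "\<not> norm (w t) < \<delta>"
        then have ne: "?C \<noteq> {}" using that by force
        have "continuous_on {0..T} (\<lambda>t. norm (w t))"
          unfolding w_def by (intro continuous_intros solution_on_continuous[OF x(1)] solution_on_continuous[OF y])
        then have "closed ?C"
          by (rule continuous_closed_preimage) auto
        then have "compact ({0..T} \<inter> ?C)"
          by (intro compact_Int_closed) auto
        then have "compact ?C" by simp
        then obtain s where s: "s \<in> ?C" "\<And>t. t \<in> ?C \<Longrightarrow> s \<le> t"
          using compact_attains_inf[OF _ ne] by blast
        have "norm (w s) \<le> K * norm (w 0)"
        proof (rule bound)
          show "s \<in> {0..T}" using s(1) by blast
          fix t assume "0 < t" "t < s"
          then have "t \<in> {0..T}" "t \<notin> ?C" using s(1) s(2)[of t] by auto
          then show "norm (w t) \<le> \<delta>" by auto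
        qed
        then show False using s(1) small by simp
      qed
      show "\<forall>t\<in>{0..T}. norm (y t - x t) \<le> K * norm (y 0 - x 0)"
        using bound near unfolding w_def[symmetric] by (meson atLeastAtMost_iff less_imp_le order_trans)
    qed (use \<delta> K in simp)
  qed
qed

section \<open>Global nonexpansion and limit sets\<close>

lemma cont_differentiable_lipschitz_cball:
  fixes h :: "'a::euclidean_space \<Rightarrow> 'b::real_normed_vector"
  assumes "cont_differentiable h"
  obtains L where "0 \<le> L"
    "\<And>x y. norm x \<le> R \<Longrightarrow> norm y \<le> R \<Longrightarrow> norm (h x - h y) \<le> L * norm (x - y)"
proof -
  obtain h' where h': "\<And>x. (h has_derivative blinfun_apply (h' x)) (at x)" "continuous_on UNIV h'"
    using cont_differentiableE[OF assms] by metis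
  have "bounded (h' ` cball 0 R)"
    by (intro compact_imp_bounded compact_continuous_image continuous_on_subset[OF h'(2)]) auto
  then obtain L where L: "0 < L" "\<And>x. x \<in> cball 0 R \<Longrightarrow> norm (h' x) \<le> L"
    unfolding bounded_pos by auto
  have "norm (h x - h y) \<le> L * norm (x - y)" if "norm x \<le> R" "norm y \<le> R" for x y
    by (rule differentiable_bound[where S = "cball 0 R" and f' = "\<lambda>x. blinfun_apply (h' x)"])
      (use that L has_derivative_at_withinI[OF h'(1)] in \<open>auto simp flip: norm_blinfun.rep_eq\<close>)
  then show ?thesis using that[of L] L by auto
qed

lemma trajectory_shift:
  assumes "trajectory h x" "0 \<le> s"
  shows "trajectory h (\<lambda>t. x (t + s))"
  unfolding solution_on_def
proof
  fix t :: real assume t: "t \<in> {0..}"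
  have "(x has_vector_derivative h (x (t + s))) (at (t + s) within (\<lambda>t. t + s) ` {0..})"
    by (rule has_vector_derivative_within_subset[of _ _ _ "{0..}"])
      (use assms t in \<open>auto simp: solution_on_def\<close>)
  then have "(x \<circ> (\<lambda>t. t + s) has_vector_derivative 1 *\<^sub>R h (x (t + s))) (at t within {0..})"
    by (intro vector_diff_chain_within) (auto intro!: derivative_eq_intros)
  then show "((\<lambda>t. x (t + s)) has_vector_derivative h (x (t + s))) (at t within {0..})"
    by (simp add: o_def)
qed

lemma trajectory_const: "h c = 0 \<Longrightarrow> solution_on h (\<lambda>_. c) J"
  by (simp add: solution_on_def)

text \<open>All that later arguments need from the metric \<open>M\<close> is the single constant
  \<open>K\<close>; \<open>nearby\<close> is the conclusion of
  \<open>semi_contracting_nearby\<close> for that constant.\<close>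

locale locally_nonexpanding =
  fixes h :: "real^'n::finite \<Rightarrow> real^'n" and K :: real
  assumes K_pos: "0 < K"
    and h_C1: "cont_differentiable h"
    and nearby: "\<And>R T. 0 \<le> T \<Longrightarrow> \<exists>d>0. \<forall>x y g.
       solution_on h x {0..T} \<longrightarrow> (\<forall>t\<in>{0..T}. norm (x t) \<le> R) \<longrightarrow>
       solution_on g y {0..T} \<longrightarrow> (\<forall>z. norm z \<le> R + 1 \<longrightarrow> g z = h z) \<longrightarrow>
       norm (y 0 - x 0) \<le> d \<longrightarrow> (\<forall>t\<in>{0..T}. norm (y t - x t) \<le> K * norm (y 0 - x 0))"
    and ex_bounded: "\<exists>\<xi>. trajectory h \<xi> \<and> bounded (\<xi> ` {0..})"
begin

text \<open>This is \<open>nearby\<close> with \<open>g = h\<close> and initial distance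
  zero.\<close>

lemma solution_unique:
  assumes "solution_on h x {0..T}" "solution_on h y {0..T}" "0 \<le> T" "x 0 = y 0"
  shows "x T = y T"
proof -
  have "bounded (x ` {0..T})"
    by (intro compact_imp_bounded compact_continuous_image solution_on_continuous[OF assms(1)]) simp
  then obtain R where "\<forall>t\<in>{0..T}. norm (x t) \<le> R"
    by (auto simp: bounded_iff)
  with nearby[OF assms(3), of R] assms show ?thesis
    by (metis atLeastAtMost_iff diff_self eq_iff_diff_eq_0 less_imp_le mult_zero_right norm_le_zero_iff norm_zero order_refl)
qed

text \<open>A solution of the globally Lipschitz field \<open>g\<close>, which agrees with \<open>h\<close> on a large ball, is
  reached from \<open>\<xi>\<close> through a chain of nearby solutions; the chain keeps it inside the ball.\<close>

lemma ex_trajectory_near: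
  assumes \<xi>: "trajectory h \<xi>" and "bounded (\<xi> ` {0..})"
  shows "\<exists>x. trajectory h x \<and> x 0 = p \<and> (\<forall>t\<ge>0. norm (x t - \<xi> t) \<le> K * norm (p - \<xi> 0))"
proof -
  obtain R0 where R0: "\<And>t. 0 \<le> t \<Longrightarrow> norm (\<xi> t) \<le> R0"
    using assms(2) by (auto simp: bounded_iff)
  define r where "r = K * norm (p - \<xi> 0)"
  have r: "0 \<le> r" using K_pos by (simp add: r_def)
  \<comment> \<open>This radius contains \<xi> and every solution within \<open>r\<close> of it,
    hence each member of the chain.\<close>
  define R where "R = R0 + r"
  define C :: "(real^'n) set" where "C = cball 0 (R + 1)"
  have "0 \<le> R" using R0[of 0] r norm_ge_zero[of "\<xi> 0"] unfolding R_def by linarith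
  then have C: "convex C" "closed C" "C \<noteq> {}" by (auto simp: C_def)
  \<comment> \<open>Projection onto a closed convex set is nonexpansive, so \<open>g\<close>
    inherits globally the Lipschitz constant of \<open>h\<close> on the ball.\<close>
  define g where "g z = h (closest_point C z)" for z
  have g_eq: "g z = h z" if "norm z \<le> R + 1" for z
    using that closest_point_self[of z C] by (simp add: g_def C_def)
  obtain L where L: "0 \<le> L"
    "\<And>x y. norm x \<le> R + 1 \<Longrightarrow> norm y \<le> R + 1 \<Longrightarrow> norm (h x - h y) \<le> L * norm (x - y)"
    using cont_differentiable_lipschitz_cball[OF h_C1] by metis
  have "norm (g x - g y) \<le> L * norm (x - y)" for x y
  proof -
    have "norm (closest_point C z) \<le> R + 1" for z
      using closest_point_in_set[OF C(2,3), of z] by (simp add: C_def)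
    then have "norm (g x - g y) \<le> L * norm (closest_point C x - closest_point C y)"
      unfolding g_def by (intro L(2))
    also have "\<dots> \<le> L * norm (x - y)"
      using closest_point_lipschitz[OF C, of x y] L(1) by (auto simp: dist_norm intro: mult_left_mono)
    finally show ?thesis .
  qed
  from ex_trajectory_lipschitz[OF this] obtain sol
    where sol: "\<And>q. sol q 0 = q" "\<And>q. trajectory g (sol q)"
    by metis
  \<comment> \<open>The chain is chosen anew for each \<open>T\<close>, but the bound
    \<open>r\<close> is the same for all, so the one curve \<open>sol p\<close> is controlled at all
    times.\<close>
  have near: "norm (sol p t - \<xi> t) \<le> r" if T: "0 \<le> T" "t \<in> {0..T}" for t T
  proof -
    obtain d where d: "0 < d" and A: "\<And>x y g t. solution_on h x {0..T} \<Longrightarrow>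
       (\<And>t. t \<in> {0..T} \<Longrightarrow> norm (x t) \<le> R) \<Longrightarrow>
       solution_on g y {0..T} \<Longrightarrow> (\<And>z. norm z \<le> R + 1 \<Longrightarrow> g z = h z) \<Longrightarrow>
       norm (y 0 - x 0) \<le> d \<Longrightarrow> t \<in> {0..T} \<Longrightarrow> norm (y t - x t) \<le> K * norm (y 0 - x 0)"
      using nearby[OF T(1), of R] by blast
    define v where "v = p - \<xi> 0"
    \<comment> \<open>The segment from \<open>\<xi> 0\<close> to \<open>p\<close> is cut into
      \<open>N\<close> pieces shorter than \<open>d\<close>.\<close>
    obtain N :: nat where N: "norm v / d < real N"
      using reals_Archimedean2 by blast
    then have Npos: "0 < real N"
      using d by (smt (verit) divide_nonneg_pos norm_ge_zero)
    define q where "q i = \<xi> 0 + (real i / real N) *\<^sub>R v" for i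
    have sol_T: "solution_on g (sol q) {0..T}" for q
      by (rule solution_on_subset[OF sol(2)]) auto
    have step: "norm (q (Suc i) - q i) = norm v / N" for i
    proof -
      have "q (Suc i) - q i = (1 / N) *\<^sub>R v"
        using Npos by (simp add: q_def add_divide_distrib flip: scaleR_diff_left)
      then show ?thesis by simp
    qed
    \<comment> \<open>The accumulated distance never exceeds \<open>r\<close>, so
      \<open>sol (q i)\<close> stays within radius \<open>R\<close>, solves the equation for
      \<open>h\<close> there, and can serve as the reference solution for the next link.\<close>
    have chain: "norm (sol (q i) t - \<xi> t) \<le> real i * (K * (norm v / N))"
      if "i \<le> N" "t \<in> {0..T}" for i t
      using that
    proof (induction i arbitrary: t)
      case 0
      have "norm (sol (q 0) t - \<xi> t) \<le> K * norm (sol (q 0) 0 - \<xi> 0)"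
      proof (rule A[OF _ _ sol_T])
        show "solution_on h \<xi> {0..T}" by (rule solution_on_subset[OF \<xi>]) auto
        show "norm (\<xi> t) \<le> R" if "t \<in> {0..T}" for t
          using R0[of t] that r by (simp add: R_def)
      qed (use g_eq 0 d sol in \<open>auto simp: q_def\<close>)
      then show ?case by (simp add: sol q_def)
    next
      case (Suc i)
      have bd: "norm (sol (q i) s) \<le> R" if s: "s \<in> {0..T}" for s
      proof -
        have "norm (sol (q i) s) \<le> norm (\<xi> s) + norm (sol (q i) s - \<xi> s)"
          by (rule norm_triangle_sub)
        also have "norm (sol (q i) s - \<xi> s) \<le> real i * (K * (norm v / N))"
          using Suc s by simp
        also have "\<dots> \<le> real N * (K * (norm v / N))"
          using Suc K_pos by (intro mult_right_mono) auto
        also have "\<dots> = r" using Npos by (simp add: r_def v_def)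
        finally show ?thesis using R0[of s] s by (simp add: R_def)
      qed
      have "solution_on h (sol (q i)) {0..T}"
        using sol_T[of "q i"] g_eq bd unfolding solution_on_def by fastforce
      then have "norm (sol (q (Suc i)) t - sol (q i) t) \<le> K * norm (sol (q (Suc i)) 0 - sol (q i) 0)"
        using bd g_eq Suc.prems N d
        by (intro A[OF _ _ sol_T]) (auto simp: sol step field_simps)
      also have "\<dots> = K * (norm v / N)" by (simp add: sol step)
      finally have "norm (sol (q (Suc i)) t - sol (q i) t) \<le> K * (norm v / N)" .
      moreover have "norm (sol (q i) t - \<xi> t) \<le> real i * (K * (norm v / N))"
        using Suc by simp
      moreover have "norm (sol (q (Suc i)) t - \<xi> t)
          \<le> norm (sol (q (Suc i)) t - sol (q i) t) + norm (sol (q i) t - \<xi> t)"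
        using norm_triangle_ineq[of "sol (q (Suc i)) t - sol (q i) t" "sol (q i) t - \<xi> t"] by simp
      ultimately show ?case
        unfolding of_nat_Suc distrib_right mult_1_left by linarith
    qed
    have "q N = p" using Npos by (simp add: q_def v_def)
    then show ?thesis
      using chain[of N t] T Npos by (simp add: r_def v_def)
  qed
  have near': "norm (sol p t - \<xi> t) \<le> r" if "0 \<le> t" for t
    using near[of t t] that by simp
  have "g (sol p t) = h (sol p t)" if "0 \<le> t" for t
    using g_eq[of "sol p t"] near'[OF that] R0[OF that] norm_triangle_sub[of "sol p t" "\<xi> t"]
    by (simp add: R_def)
  then have "trajectory h (sol p)"
    using sol(2)[of p] unfolding solution_on_def by simp
  then show ?thesis
    using sol(1) near' unfolding r_def by blast
qed

section \<open>Existence, boundedness and nonexpansion for arbitrary initial values\<close>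

lemma ex_bounded_trajectory: "\<exists>x. trajectory h x \<and> x 0 = p \<and> bounded (x ` {0..})"
proof -
  obtain \<xi> where \<xi>: "trajectory h \<xi>" "bounded (\<xi> ` {0..})" using ex_bounded by blast
  obtain x where x: "trajectory h x" "x 0 = p" "\<And>t. t \<ge> 0 \<Longrightarrow> norm (x t - \<xi> t) \<le> K * norm (p - \<xi> 0)"
    using ex_trajectory_near[OF \<xi>] by metis
  obtain R where R: "\<And>t. t \<ge> 0 \<Longrightarrow> norm (\<xi> t) \<le> R"
    using \<xi>(2) by (auto simp: bounded_iff)
  have "norm (x t) \<le> R + K * norm (p - \<xi> 0)" if "t \<ge> 0" for t
    using x(3)[OF that] R[OF that] norm_triangle_sub[of "x t" "\<xi> t"] by linarith
  then show ?thesis using x(1,2) by (force simp: bounded_iff)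
qed

lemma trajectory_extends:
  assumes "solution_on h x {0..T}" "trajectory h y" "x 0 = y 0" "t \<in> {0..T}"
  shows "x t = y t"
  by (rule solution_unique[of _ t]) (use assms in \<open>auto intro: solution_on_subset\<close>)

lemma trajectory_bounded:
  assumes "trajectory h x"
  shows "bounded (x ` {0..})"
proof -
  obtain y where y: "trajectory h y" "y 0 = x 0" "bounded (y ` {0..})"
    using ex_bounded_trajectory by blast
  have "x t = y t" if "0 \<le> t" for t
    by (rule solution_unique[of _ t]) (use assms y that in \<open>auto intro: solution_on_subset\<close>)
  then have "x ` {0..} = y ` {0..}" by force
  then show ?thesis using y by simp
qed

text \<open>The trajectory from \<open>y 0\<close> is itself bounded and can take the place of \<xi>
  in \<open>ex_trajectory_near\<close>; uniqueness carries the estimate over to the given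
  solutions.\<close>

lemma nonexpanding:
  assumes "solution_on h x {0..T}" "solution_on h y {0..T}" "0 \<le> T"
  shows "norm (x T - y T) \<le> K * norm (x 0 - y 0)"
proof -
  obtain y' where y': "trajectory h y'" "y' 0 = y 0" "bounded (y' ` {0..})"
    using ex_bounded_trajectory by blast
  obtain x' where x': "trajectory h x'" "x' 0 = x 0"
      "\<And>t. t \<ge> 0 \<Longrightarrow> norm (x' t - y' t) \<le> K * norm (x 0 - y' 0)"
    using ex_trajectory_near[OF y'(1,3)] by metis
  have "x T = x' T" "y T = y' T"
    using trajectory_extends[of _ T _ T] assms x' y' by auto
  then show ?thesis using x'(3)[OF assms(3)] y' by simp
qed

lemma trajectory_nonexpanding:
  assumes "trajectory h x" "trajectory h y" "0 \<le> s" "s \<le> t"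
  shows "norm (x t - y t) \<le> K * norm (x s - y s)"
proof -
  have "solution_on h (\<lambda>t. z (t + s)) {0..t - s}" if "trajectory h z" for z
    by (rule solution_on_subset[OF trajectory_shift[OF that assms(3)]]) auto
  from nonexpanding[OF this[OF assms(1)] this[OF assms(2)]] show ?thesis
    using assms(4) by simp
qed

text \<open>The radius \<open>\<rho> / (2 * K)\<close> works at every point, so that the basin of attraction and its
  complement are both open.\<close>

lemma locally_attractive_imp_globally:
  assumes local: "\<And>x. trajectory h x \<Longrightarrow> norm (x 0 - c) < \<rho> \<Longrightarrow> (x \<longlongrightarrow> c) at_top"
    and \<rho>: "0 < \<rho>" and x: "trajectory h x"
  shows "(x \<longlongrightarrow> c) at_top"
proof -
  have spread: "(y \<longlongrightarrow> c) at_top"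
    if z: "trajectory h z" "(z \<longlongrightarrow> c) at_top" and y: "trajectory h y"
      and zy: "norm (y 0 - z 0) < \<rho> / (2 * K)" for y z
  proof -
    \<comment> \<open>Once \<open>z\<close> is within half the radius of \<open>c\<close>,
      nonexpansion places \<open>y\<close> inside the full radius, and \<open>local\<close> applies
      to \<open>y\<close> restarted at that time.\<close>
    have "\<forall>\<^sub>F t in at_top. dist (z t) c < \<rho> / 2"
      using z(2) \<rho> by (intro tendstoD) auto
    then obtain s where s: "0 \<le> s" "dist (z s) c < \<rho> / 2"
      by (metis (no_types, lifting) eventually_at_top_linorder linorder_linear)
    have "norm (y s - z s) \<le> K * norm (y 0 - z 0)"
      by (rule trajectory_nonexpanding) (use y z s in auto)
    also have "\<dots> < \<rho> / 2" using zy K_pos by (simp add: field_simps)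
    finally have "norm (y s - c) < \<rho>"
      using s(2) norm_triangle_ineq[of "y s - z s" "z s - c"] by (simp add: dist_norm)
    then have "((\<lambda>t. y (t + s)) \<longlongrightarrow> c) at_top"
      using local[OF trajectory_shift[OF y s(1)]] by simp
    moreover have "filterlim (\<lambda>t. t - s) at_top at_top"
      unfolding filterlim_at_top eventually_at_top_linorder by (metis le_diff_eq)
    ultimately have "((\<lambda>t. y (t - s + s)) \<longlongrightarrow> c) at_top"
      by (rule filterlim_compose)
    then show ?thesis by simp
  qed
  define B where "B = {p. \<forall>y. trajectory h y \<and> y 0 = p \<longrightarrow> (y \<longlongrightarrow> c) at_top}"
  have iff: "q \<in> B" if "p \<in> B" "norm (q - p) < \<rho> / (2 * K)" for p q
    using spread that ex_bounded_trajectory[of p] unfolding B_def by blast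
  have r: "\<rho> / (2 * K) > 0" using \<rho> K_pos by simp
  have "open B"
    unfolding open_dist using r iff by (metis dist_norm)
  moreover have "open (- B)"
    unfolding open_dist using r iff by (metis ComplD ComplI dist_commute dist_norm)
  moreover have "c \<in> B" using local \<rho> by (auto simp: B_def)
  ultimately have "B = UNIV"
    using clopen[of B] by (auto simp: closed_def)
  then show ?thesis using x unfolding B_def by blast
qed

section \<open>Limit sets of trajectories\<close>

definition omega_limit :: "(real \<Rightarrow> real^'n) \<Rightarrow> (real^'n) set" where
  "omega_limit x = (\<Inter>s\<in>{0..}. closure (x ` {s..}))"

lemma omega_limit_iff:
  "z \<in> omega_limit x \<longleftrightarrow> (\<forall>s\<ge>0. \<forall>e>0. \<exists>t\<ge>s. dist (x t) z < e)"
  by (auto simp: omega_limit_def closure_approachable)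

lemma closed_omega_limit: "closed (omega_limit x)"
  by (auto simp: omega_limit_def)

text \<open>The samples at integer times lie in a compact set; the limit of a convergent subsequence
  is a limit point of the trajectory.\<close>

lemma omega_limit_nonempty:
  assumes "trajectory h x"
  shows "omega_limit x \<noteq> {}"
proof -
  have "seq_compact (closure (x ` {0..}))"
    using trajectory_bounded[OF assms] compact_closure compact_eq_seq_compact_metric by blast
  moreover have "x (real k) \<in> closure (x ` {0..})" for k
    by (intro closure_subset[THEN subsetD]) auto
  ultimately obtain z r where r: "strict_mono r" "((\<lambda>k. x (real k)) \<circ> r) \<longlonglongrightarrow> z"
    unfolding seq_compact_def by metis
  have "z \<in> omega_limit x"
    unfolding omega_limit_iff
  proof (intro allI impI)
    fix s e :: real assume "0 < e"
    then have "\<forall>\<^sub>F k in sequentially. dist (x (real (r k))) z < e"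
      using tendstoD[OF r(2)] by (simp add: o_def)
    moreover have "\<forall>\<^sub>F k in sequentially. s \<le> real (r k)"
      by (metis eventually_compose_filterlim eventually_ge_at_top filterlim_compose
          filterlim_real_sequentially filterlim_subseq r(1))
    ultimately have "\<forall>\<^sub>F k in sequentially. dist (x (real (r k))) z < e \<and> s \<le> real (r k)"
      by (rule eventually_conj)
    then show "\<exists>t\<ge>s. dist (x t) z < e"
      using eventually_happens'[OF sequentially_bot] by blast
  qed
  then show ?thesis by blast
qed

text \<open>Nonexpansion replaces continuous dependence on initial values: whenever
  \<open>x t\<close> is close to \<open>y 0\<close>, the point \<open>x (T + t)\<close> is close to
  \<open>y T\<close>.\<close>

lemma forward_invariant_omega_limit:
  assumes x: "trajectory h x"
  shows "forward_invariant h (omega_limit x)"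
  unfolding forward_invariant_def
proof (intro allI impI)
  fix y T assume "0 \<le> T \<and> solution_on h y {0..T} \<and> y 0 \<in> omega_limit x"
  then have y: "0 \<le> T" "solution_on h y {0..T}" "y 0 \<in> omega_limit x" by auto
  show "y T \<in> omega_limit x"
    unfolding omega_limit_iff
  proof (intro allI impI)
    fix s e :: real assume "0 \<le> s" "0 < e"
    then obtain t where t: "t \<ge> s" "dist (x t) (y 0) < e / K"
      using y(3) K_pos unfolding omega_limit_iff by (meson divide_pos_pos)
    have "solution_on h (\<lambda>u. x (u + t)) {0..T}"
      by (rule solution_on_subset[OF trajectory_shift[OF x]]) (use t \<open>0 \<le> s\<close> in auto)
    from nonexpanding[OF this y(2,1)] have "dist (x (T + t)) (y T) < e"
      using t(2) K_pos by (simp add: dist_norm field_simps)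
    then show "\<exists>t\<ge>s. dist (x t) (y T) < e"
      using t(1) y(1) by (intro exI[of _ "T + t"]) auto
  qed
qed

end

section \<open>Convergence to the equilibrium\<close>

lemma semi_contracting_locally_nonexpanding:
  assumes "cont_differentiable h" "bounded_metric M" "semi_contracting h M"
    and "\<exists>\<xi>. trajectory h \<xi> \<and> bounded (\<xi> ` {0..})"
  shows "\<exists>K. locally_nonexpanding h K"
  by (rule semi_contracting_nearby[OF assms(1-3)], rule exI, rule locally_nonexpanding.intro)
    (assumption | rule assms)+

lemma contraction_form_le:
  assumes "contraction_lhs h P x \<preceq>\<^sub>L (- 2 * \<alpha>) *\<^sub>R P x"
  shows "v \<bullet> (contraction_lhs h P x *v v) \<le> - (2 * \<alpha>) * (v \<bullet> (P x *v v))"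
  using loewner_leD[OF assms, of v]
  unfolding scaleR_matrix_vector_assoc[symmetric] inner_scaleR_right by simp

lemma forward_invariantD:
  assumes "forward_invariant h S" "trajectory h x" "x 0 \<in> S" "0 \<le> t"
  shows "x t \<in> S"
  using assms solution_on_subset[OF assms(2), of "{0..t}"] unfolding forward_invariant_def by auto

lemma orbital_deriv_has_derivative:
  assumes "cont_differentiable V" "solution_on h x J" "t \<in> J"
  shows "((\<lambda>t. V (x t)) has_vector_derivative orbital_deriv h V (x t)) (at t within J)"
  using has_vector_derivative_along[OF assms(1), of x "h (x t)" t J] assms
  by (simp add: orbital_deriv_eq solution_on_def)

lemma orbital_deriv_nonpos_decreasing:
  assumes V: "cont_differentiable V" "\<And>x. orbital_deriv h V x \<le> 0"
    and x: "trajectory h x" and "0 \<le> s" "s \<le> t"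
  shows "V (x t) \<le> V (x s)"
proof -
  have "solution_on h (\<lambda>u. x (u + s)) {0..t - s}"
    by (rule solution_on_subset[OF trajectory_shift[OF x]]) (use assms in auto)
  \<comment> \<open>With \<open>c = 0\<close> the differential inequality expresses
    monotonicity.\<close>
  from gronwall_differential[where f = "\<lambda>u. V (x (u + s))" and T = "t - s" and c = 0,
      OF _ orbital_deriv_has_derivative[OF V(1) this, folded has_real_derivative_iff_has_vector_derivative]]
  show ?thesis using assms by simp
qed

text \<open>The Lyapunov function \<open>U\<close> decays exponentially and dominates the squared
  norm of \<open>w\<close>.\<close>

lemma quadratic_decay:
  fixes U :: "real \<Rightarrow> real" and w :: "real \<Rightarrow> 'a::real_normed_vector"
  assumes "0 < a" "0 < b"
    and U: "\<And>t. 0 \<le> t \<Longrightarrow> (U has_real_derivative U' t) (at t within {0..})"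
    and le: "\<And>t. 0 \<le> t \<Longrightarrow> U' t \<le> - b * U t"
    and w: "\<And>t. 0 \<le> t \<Longrightarrow> a * (norm (w t))\<^sup>2 \<le> U t"
  shows "(w \<longlongrightarrow> 0) at_top"
proof -
  have "(norm (w t))\<^sup>2 \<le> exp (- b * t) * (U 0 / a)" if "0 \<le> t" for t
  proof -
    have "(U has_real_derivative U' s) (at s within {0..t})" if "s \<in> {0..t}" for s
      by (rule DERIV_subset[OF U]) (use that in auto)
    then have "U t \<le> exp (- b * t) * U 0"
      by (rule gronwall_differential[OF that]) (use le in auto)
    then show ?thesis using w[OF that] \<open>0 < a\<close> by (simp add: field_simps)
  qed
  moreover have "((\<lambda>t. exp (- b * t) * (U 0 / a)) \<longlongrightarrow> 0) at_top"
  proof (rule tendsto_mult_left_zero, rule filterlim_compose[OF exp_at_bot])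
    show "filterlim (\<lambda>t. - b * t) at_bot at_top"
      using \<open>0 < b\<close> by (intro filterlim_tendsto_neg_mult_at_bot[OF tendsto_const] filterlim_ident) auto
  qed
  ultimately have "((\<lambda>t. (norm (w t))\<^sup>2) \<longlongrightarrow> 0) at_top"
    by (intro tendsto_sandwich[of "\<lambda>_. 0" "\<lambda>t. (norm (w t))\<^sup>2" at_top "\<lambda>t. exp (- b * t) * (U 0 / a)"])
      (auto intro: eventually_mono[OF eventually_ge_at_top[of 0]])
  then have "((\<lambda>t. sqrt ((norm (w t))\<^sup>2)) \<longlongrightarrow> sqrt 0) at_top"
    by (rule tendsto_real_sqrt)
  then show ?thesis by (simp add: tendsto_norm_zero_iff)
qed

text \<open>A convergent half-line becomes a path when time is compressed to the unit interval and
  the limit is added as its endpoint.\<close>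

lemma path_component_limit:
  fixes x :: "real \<Rightarrow> 'a::topological_space"
  assumes x: "continuous_on {0..} x" "(x \<longlongrightarrow> c) at_top" and S: "\<And>t. 0 \<le> t \<Longrightarrow> x t \<in> S" "c \<in> S"
  shows "path_component S (x 0) c"
proof -
  \<comment> \<open>This equals \<open>s / (1 - s)\<close> for \<open>s < 1\<close>: it starts at 0
    and tends to infinity as \<open>s\<close> approaches 1 from the left.\<close>
  define \<tau> where "\<tau> s = - 1 + inverse (1 - s)" for s :: real
  define p where "p s = (if s = 1 then c else x (\<tau> s))" for s
  have \<tau>: "0 \<le> \<tau> s" if "0 \<le> s" "s < 1" for s
    using that by (simp add: \<tau>_def one_le_inverse)
  have "continuous_on {0..<1} (\<lambda>s. x (\<tau> s))"
    by (rule continuous_on_compose2[OF x(1)]) (use \<tau> in \<open>auto simp: \<tau>_def[abs_def] intro!: continuous_intros\<close>)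
  then have "continuous_on {0..<1} p"
    by (rule continuous_on_eq) (simp add: p_def)
  moreover have "(p \<longlongrightarrow> c) (at_left 1)"
  proof -
    have "filterlim (\<lambda>s :: real. inverse (1 - s)) at_top (at_left 1)"
      by (rule filterlim_inverse_at_top)
        (auto intro!: tendsto_eq_intros simp: eventually_at_filter)
    then have "filterlim \<tau> at_top (at_left 1)"
      unfolding \<tau>_def by (rule filterlim_tendsto_add_at_top[OF tendsto_const])
    from filterlim_compose[OF x(2) this] show ?thesis
      by (rule Lim_transform_eventually) (auto simp: p_def eventually_at_filter)
  qed
  ultimately have "continuous_on {0..1} p"
    unfolding continuous_on_def
  proof (intro ballI)
    fix s :: real assume cont: "\<forall>s\<in>{0..<1}. (p \<longlongrightarrow> p s) (at s within {0..<1})"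
      and left: "(p \<longlongrightarrow> c) (at_left 1)" and s: "s \<in> {0..1}"
    show "(p \<longlongrightarrow> p s) (at s within {0..1})"
    proof (cases "s = 1")
      case True
      then show ?thesis using left at_within_Icc_at_left[of 0 "1 :: real"] by (simp add: p_def)
    next
      case False
      have "at s within {0..1} = at s within {0..<1}"
        by (rule at_within_nhd[where S = "{..<1}"]) (use s False in auto)
      then show ?thesis using cont s False by simp
    qed
  qed
  then show ?thesis
    unfolding path_component_def path_def path_image_def pathstart_def pathfinish_def
    using S \<tau> by (intro exI[of _ p]) (auto simp: p_def \<tau>_def[of 0])
qed

section \<open>LaSalle's argument and attraction to equilibria\<close>

context locally_nonexpanding
begin

text \<open>Monotonicity of \<open>V\<close> along \<open>x\<close> forces one common value at all
  limit points. By invariance \<open>V\<close> is then constant along any trajectory starting in the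
  limit set, so its derivative at time 0 vanishes.\<close>

lemma stationary_omega_limit:
  assumes V: "cont_differentiable V" "\<And>x. orbital_deriv h V x \<le> 0" and x: "trajectory h x"
  shows "stationary_invariant h V (omega_limit x)"
  unfolding stationary_invariant_def
proof (intro conjI ballI)
  show inv: "forward_invariant h (omega_limit x)"
    by (rule forward_invariant_omega_limit[OF x])
  have near: "\<exists>t\<ge>s. dist (V (x t)) (V z) < e" if z: "z \<in> omega_limit x" "0 < e" "0 \<le> s" for z e s
  proof -
    obtain d where "0 < d" "\<And>y. dist y z < d \<Longrightarrow> dist (V y) (V z) < e"
      using cont_differentiable_continuous[OF V(1), of UNIV] z(2)
      unfolding continuous_on_iff by (metis UNIV_I)
    then show ?thesis
      using z(1,3) unfolding omega_limit_iff by meson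
  qed
  \<comment> \<open>The trajectory passes near \<open>z2\<close> at some time and near
    \<open>z1\<close> at a later one; the decrease of \<open>V\<close> between them gives the
    inequality up to \<open>e\<close>.\<close>
  have "V z1 \<le> V z2" if z: "z1 \<in> omega_limit x" "z2 \<in> omega_limit x" for z1 z2
  proof (rule field_le_epsilon)
    fix e :: real assume "0 < e"
    then obtain s where s: "0 \<le> s" "dist (V (x s)) (V z2) < e / 2"
      using near[OF z(2), of "e / 2" 0] by auto
    then obtain t where t: "s \<le> t" "dist (V (x t)) (V z1) < e / 2"
      using near[OF z(1), of "e / 2" s] \<open>0 < e\<close> by auto
    show "V z1 \<le> V z2 + e"
      using orbital_deriv_nonpos_decreasing[OF V x s(1) t(1)] s(2) t(2) unfolding dist_real_def by linarith
  qed
  then have const: "V z1 = V z2" if "z1 \<in> omega_limit x" "z2 \<in> omega_limit x" for z1 z2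
    using that by (meson antisym)
  fix z assume z: "z \<in> omega_limit x"
  obtain y where y: "trajectory h y" "y 0 = z"
    using ex_bounded_trajectory by blast
  have "((\<lambda>t. V (y t)) has_vector_derivative orbital_deriv h V (y 0)) (at 0 within {0..1})"
    using orbital_deriv_has_derivative[OF V(1) solution_on_subset[OF y(1)], of "{0..1}" 0] by simp
  moreover have "((\<lambda>t. V (y t)) has_vector_derivative 0) (at 0 within {0..1})"
  proof (rule has_vector_derivative_transform)
    show "V (y t) = V z" if "t \<in> {0..1}" for t
      using const[OF forward_invariantD[OF inv y(1)] z] y(2) z that by simp
    show "((\<lambda>t. V z) has_vector_derivative 0) (at 0 within {0..1})"
      by (rule has_vector_derivative_const)
  qed simp
  ultimately have "orbital_deriv h V (y 0) = 0"
    by (rule vector_derivative_unique_within[rotated])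
      (simp add: trivial_limit_within islimpt_Icc)
  then show "orbital_deriv h V z = 0" using y(2) by simp
qed

text \<open>The velocity \<open>h (x t)\<close> solves the variational equation, so it decays in the metric \<open>P\<close>.\<close>

lemma contracting_invariant_has_equilibrium:
  assumes P: "is_metric P" "0 < \<alpha>" "contracting_on S h P \<alpha>"
    and S: "closed S" "forward_invariant h S" "z \<in> S"
  shows "\<exists>c\<in>S. h c = 0"
proof -
  obtain x where x: "trajectory h x" "x 0 = z" using ex_bounded_trajectory by blast
  have xS: "x t \<in> S" if "0 \<le> t" for t
    using forward_invariantD[OF S(2) x(1) _ that] x(2) S(3) by simp
  obtain R where R: "\<And>t. 0 \<le> t \<Longrightarrow> x t \<in> cball 0 R"
    using trajectory_bounded[OF x(1)] by (auto simp: bounded_iff)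
  \<comment> \<open>The trajectory stays in a ball, so \<open>P\<close> is uniformly coercive along
    it.\<close>
  obtain a where a: "0 < a" "\<And>x v. x \<in> cball 0 R \<Longrightarrow> a * (norm v)\<^sup>2 \<le> v \<bullet> (P x *v v)"
    using metric_coercive[OF P(1) compact_cball] by blast
  define v where "v t = h (x t)" for t
  have "(v \<longlongrightarrow> 0) at_top"
  proof (rule quadratic_decay[OF a(1)])
    show "0 < 2 * \<alpha>" using P(2) by simp
    fix t :: real assume t: "0 \<le> t"
    have xt: "(x has_vector_derivative h (x t)) (at t within {0..})"
      using x(1) t by (simp add: solution_on_def)
    from has_vector_derivative_along[OF h_C1 xt]
    have "(v has_vector_derivative jacobian h (at (x t)) *v v t) (at t within {0..})"
      unfolding v_def by (simp add: jacobian_vector[OF h_C1])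
    from metric_form_has_derivative[where P = P and h = h and x = x and w = v, OF P(1) xt this]
    show "((\<lambda>t. v t \<bullet> (P (x t) *v v t)) has_real_derivative
        v t \<bullet> (contraction_lhs h P (x t) *v v t)) (at t within {0..})"
      by (simp add: contraction_lhs_form[of P, OF is_metricD(2)[OF P(1)]])
    show "v t \<bullet> (contraction_lhs h P (x t) *v v t) \<le> - (2 * \<alpha>) * (v t \<bullet> (P (x t) *v v t))"
      using contraction_form_le P(3) xS[OF t] unfolding contracting_on_def by blast
    show "a * (norm (v t))\<^sup>2 \<le> v t \<bullet> (P (x t) *v v t)"
      using a(2) R[OF t] by blast
  qed
  \<comment> \<open>The velocity tends to zero and \<open>h\<close> is continuous, so every limit
    point is an equilibrium.\<close>
  obtain c where c: "c \<in> omega_limit x"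
    using omega_limit_nonempty[OF x(1)] by blast
  have "c \<in> closure (x ` {0..})" using c by (auto simp: omega_limit_def)
  then have "c \<in> S"
    using closure_minimal[OF _ S(1), of "x ` {0..}"] xS by auto
  moreover have "norm (h c) \<le> 0"
  proof (rule field_le_epsilon)
    fix e :: real assume e: "0 < e"
    obtain d where d: "0 < d" "\<And>y. dist y c < d \<Longrightarrow> dist (h y) (h c) < e / 2"
      using cont_differentiable_continuous[OF h_C1, of UNIV] e
      unfolding continuous_on_iff by (metis UNIV_I half_gt_zero)
    have "\<forall>\<^sub>F t in at_top. norm (v t) < e / 2"
      using tendstoD[OF \<open>(v \<longlongrightarrow> 0) at_top\<close>, of "e / 2"] e by simp
    then obtain s where s: "\<And>t. s \<le> t \<Longrightarrow> norm (v t) < e / 2"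
      by (auto simp: eventually_at_top_linorder)
    obtain t where t: "max s 0 \<le> t" "dist (x t) c < d"
      using c d(1) unfolding omega_limit_iff by (meson max.cobounded2)
    have "norm (h c) \<le> norm (v t) + dist (h (x t)) (h c)"
      using norm_triangle_sub[of "h c" "h (x t)"] by (simp add: v_def dist_norm norm_minus_commute)
    then show "norm (h c) \<le> 0 + e"
      using s[of t] d(2)[OF t(2)] t(1) by auto
  qed
  ultimately show ?thesis by auto
qed

text \<open>The form is frozen at \<open>P c\<close>, so contraction at the single point
  \<open>c\<close> is enough. Half of the rate \<open>2 * \<alpha>\<close> absorbs the linearization
  remainder near \<open>c\<close>; the other half gives decay.\<close>

lemma contracting_equilibrium_attractive:
  assumes P: "is_metric P" "0 < \<alpha>" "contraction_lhs h P c \<preceq>\<^sub>L (- 2 * \<alpha>) *\<^sub>R P c"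
    and c: "h c = 0" and x: "trajectory h x"
  shows "(x \<longlongrightarrow> c) at_top"
proof -
  obtain a where a: "0 < a" "\<And>v. a * (norm v)\<^sup>2 \<le> v \<bullet> (P c *v v)"
    using metric_coercive[OF P(1) compact_sing] by (metis singletonI)
  obtain B where B: "0 < B" "\<And>v. norm (P c *v v) \<le> B * norm v"
    using matrix_field_bound[OF cont_differentiable_continuous[OF is_metricD(1)[OF P(1)]] compact_sing]
    by (metis singletonI)
  \<comment> \<open>Chosen so that the remainder costs at most \<alpha> times the quadratic
    form.\<close>
  define e where "e = \<alpha> * a / (2 * B)"
  have e: "0 < e" "2 * (B * e) = \<alpha> * a" using a(1) B(1) P(2) by (simp_all add: e_def)
  obtain \<delta> where \<delta>: "0 < \<delta>" "\<And>x y. norm x \<le> norm c \<Longrightarrow> norm (y - x) \<le> \<delta> \<Longrightarrow>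
      norm (h y - h x - frechet_derivative h (at x) (y - x)) \<le> e * norm (y - x)"
    using uniform_linearization[OF h_C1 e(1)] by blast
  have decay: "2 * (w \<bullet> (P c *v h (c + w))) \<le> - \<alpha> * (w \<bullet> (P c *v w))" if w: "norm w \<le> \<delta>" for w
  proof -
    let ?r = "h (c + w) - jacobian h (at c) *v w"
    have r: "norm ?r \<le> e * norm w"
      using \<delta>(2)[of c "c + w"] w c by (simp add: jacobian_vector[OF h_C1])
    \<comment> \<open>The derivative of \<open>P\<close> along the flow vanishes at \<open>c\<close>
      because \<open>h c = 0\<close>, leaving only the Jacobian term.\<close>
    have "linear (frechet_derivative P (at c))"
      by (meson cont_differentiable_has_derivative has_derivative_linear is_metricD(1)[OF P(1)])
    then have "metric_deriv h P c = 0"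
      using c by (simp add: metric_deriv_eq[OF is_metricD(1)[OF P(1)]] linear_0)
    then have "2 * (w \<bullet> (P c *v (jacobian h (at c) *v w))) \<le> - (2 * \<alpha>) * (w \<bullet> (P c *v w))"
      using contraction_form_le[OF P(3), of w]
      by (simp add: contraction_lhs_form[of P, OF is_metricD(2)[OF P(1)]])
    moreover have "2 * (w \<bullet> (P c *v ?r)) \<le> \<alpha> * (w \<bullet> (P c *v w))"
    proof -
      have "norm (P c *v ?r) \<le> B * (e * norm w)"
        using B(2)[of ?r] r B(1) by (meson mult_left_mono less_imp_le order_trans)
      then have "norm w * norm (P c *v ?r) \<le> norm w * (B * (e * norm w))"
        by (rule mult_left_mono) simp
      then have "2 * (w \<bullet> (P c *v ?r)) \<le> 2 * (B * e) * (norm w)\<^sup>2"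
        using norm_cauchy_schwarz[of w "P c *v ?r"] by (simp add: power2_eq_square mult_ac)
      also have "\<dots> = \<alpha> * (a * (norm w)\<^sup>2)" unfolding e(2) by simp
      also have "\<dots> \<le> \<alpha> * (w \<bullet> (P c *v w))" using a(2) P(2) by (intro mult_left_mono) auto
      finally show ?thesis .
    qed
    ultimately show ?thesis
      by (simp add: matrix_vector_mult_diff_distrib inner_diff_right)
  qed
  show ?thesis
  proof (rule locally_attractive_imp_globally[OF _ _ x])
    \<comment> \<open>Nonexpansion relative to the constant trajectory at \<open>c\<close> keeps a
      solution that starts in this radius within \<delta> forever, so \<open>decay\<close> holds at
      all times.\<close>
    show "0 < \<delta> / K" using \<delta>(1) K_pos by simp
    fix x assume x: "trajectory h x" and near: "norm (x 0 - c) < \<delta> / K"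
    define w where "w t = x t - c" for t
    have w_small: "norm (w t) \<le> \<delta>" if "0 \<le> t" for t
    proof -
      have "norm (w t) \<le> K * norm (x 0 - c)"
        unfolding w_def using trajectory_nonexpanding[OF x trajectory_const[of h c, OF c] order_refl that] .
      then show ?thesis using near K_pos by (simp add: field_simps)
    qed
    have "(w \<longlongrightarrow> 0) at_top"
    proof (rule quadratic_decay[OF a(1) P(2)])
      fix t :: real assume t: "0 \<le> t"
      have "((\<lambda>t. x t - c) has_vector_derivative h (x t) - 0) (at t within {0..})"
        by (rule has_vector_derivative_diff[OF _ has_vector_derivative_const])
          (use x t in \<open>simp add: solution_on_def\<close>)
      then have "(w has_vector_derivative h (x t)) (at t within {0..})"
        by (simp add: w_def[abs_def])
      from quadratic_form_has_derivative[OF has_vector_derivative_const this is_metricD(2)[OF P(1), of c]]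
      show "((\<lambda>t. w t \<bullet> (P c *v w t)) has_real_derivative 2 * (w t \<bullet> (P c *v h (x t)))) (at t within {0..})"
        by simp
      show "2 * (w t \<bullet> (P c *v h (x t))) \<le> - \<alpha> * (w t \<bullet> (P c *v w t))"
        using decay[OF w_small[OF t]] by (simp add: w_def)
    qed (use a in blast)
    then show "(x \<longlongrightarrow> c) at_top"
      by (simp add: w_def[abs_def] LIM_zero_iff)
  qed
qed

end

theorem theorem4:
  fixes h :: "real^'n::finite \<Rightarrow> real^'n"
    and V :: "real^'n \<Rightarrow> real"
    and M P :: "real^'n \<Rightarrow> real^'n^'n"
    and I :: "(real^'n) set"
    and \<alpha> :: real
  assumes "cont_differentiable h" and "cont_differentiable V"
    and "bounded_metric M" and "semi_contracting h M"
    and "\<forall>x. orbital_deriv h V x \<le> 0"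
    and "\<exists>\<xi>. trajectory h \<xi> \<and> bounded (\<xi> ` {0..})"
    and "admissible_invariant h V I"
    and "is_metric P" and "\<alpha> > 0" and "contracting_on I h P \<alpha>"
  shows "path_connected I \<and>
    (\<exists>xstar\<in>I. h xstar = 0 \<and> (\<forall>y. h y = 0 \<longrightarrow> y = xstar) \<and>
       (\<forall>x0. \<exists>x. trajectory h x \<and> x 0 = x0) \<and>
       (\<forall>x. trajectory h x \<longrightarrow> (x \<longlongrightarrow> xstar) at_top) \<and>
       (\<forall>y. V xstar \<le> V y))"
proof -
  obtain K where "locally_nonexpanding h K"
    using semi_contracting_locally_nonexpanding assms(1,3,4,6) by blast
  then interpret locally_nonexpanding h K .
  have V: "\<And>x. orbital_deriv h V x \<le> 0" using assms(5) by blast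
  have I_inv: "forward_invariant h I"
    using assms(7) by (simp add: admissible_invariant_def stationary_invariant_def)
  obtain \<xi> where \<xi>: "trajectory h \<xi>" using assms(6) by blast
  \<comment> \<open>The two alternatives in \<open>admissible_invariant\<close>: either
    \<open>I\<close> itself qualifies, or maximality puts the stationary limit set of \<xi> inside
    \<open>I\<close>.\<close>
  have "\<exists>S. closed S \<and> S \<noteq> {} \<and> S \<subseteq> I \<and> forward_invariant h S"
  proof (cases "closed I \<and> I \<noteq> {}")
    case True
    then show ?thesis using I_inv by blast
  next
    case False
    then have "omega_limit \<xi> \<subseteq> I"
      using assms(7) stationary_omega_limit[OF assms(2) V \<xi>] unfolding admissible_invariant_def by blast
    then show ?thesis
      using closed_omega_limit omega_limit_nonempty[OF \<xi>] forward_invariant_omega_limit[OF \<xi>] by blast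
  qed
  then obtain S z where S: "closed S" "forward_invariant h S" "z \<in> S" "S \<subseteq> I" by blast
  have "contracting_on S h P \<alpha>" using assms(10) S(4) by (auto simp: contracting_on_def)
  then obtain c where c: "c \<in> I" "h c = 0"
    using contracting_invariant_has_equilibrium[OF assms(8,9) _ S(1-3)] S(4) by blast
  have lim: "(x \<longlongrightarrow> c) at_top" if "trajectory h x" for x
    by (rule contracting_equilibrium_attractive[OF assms(8,9) _ c(2) that])
      (use assms(10) c(1) in \<open>simp add: contracting_on_def\<close>)
  \<comment> \<open>The trajectory from \<open>y\<close> remains in \<open>I\<close> and, completed
    by its limit \<open>c\<close>, joins the two points.\<close>
  have "path_component I y c" if y: "y \<in> I" for y
  proof -
    obtain x where x: "trajectory h x" "x 0 = y" using ex_bounded_trajectory by blast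
    show ?thesis
      using path_component_limit[OF solution_on_continuous[OF x(1)] lim[OF x(1)]]
        forward_invariantD[OF I_inv x(1)] x(2) y c(1) by blast
  qed
  then have "path_connected I"
    unfolding path_connected_component by (meson path_component_sym path_component_trans)
  \<comment> \<open>Any equilibrium is a constant trajectory, and this too converges to
    \<open>c\<close>.\<close>
  moreover have "y = c" if "h y = 0" for y
    using lim[OF trajectory_const[of h y, OF that]] by (simp add: tendsto_const_iff)
  \<comment> \<open>Along the trajectory from \<open>y\<close> the cost never exceeds
    \<open>V y\<close>, and it converges to \<open>V c\<close>.\<close>
  moreover have "V c \<le> V y" for y
  proof -
    obtain x where x: "trajectory h x" "x 0 = y" using ex_bounded_trajectory by blast
    have "isCont V c"
      using cont_differentiable_continuous[OF assms(2), of UNIV]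
      by (simp add: continuous_on_eq_continuous_at)
    then have "((\<lambda>t. V (x t)) \<longlongrightarrow> V c) at_top"
      using lim[OF x(1)] isCont_tendsto_compose by blast
    moreover have "\<forall>\<^sub>F t in at_top. V (x t) \<le> V y"
      using eventually_ge_at_top[of 0]
      by (rule eventually_mono) (use orbital_deriv_nonpos_decreasing[OF assms(2) V x(1), of 0] x(2) in auto)
    ultimately show ?thesis
      by (rule tendsto_upperbound) simp
  qed
  ultimately show ?thesis
    using c lim ex_bounded_trajectory by blast
qed

end
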